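(* Let $\mathbf{k}$ be a commutative ring and $q\in\mathbf{k}$. Let $n\in\mathbb{N}$ and $\alpha\in\mathrm{Comp}_n$. Then the antipode $S$ of $\mathrm{QSym}$ satisfies $$S\left(\eta_\alpha^{(q)}\right)=(-1)^{\ell(\alpha)}\sum_{\beta\in\mathrm{Comp}_n;\ D(\beta)\subseteq D(\mathrm{rev}\,\alpha)}(q-1)^{\ell(\alpha)-\ell(\beta)}\,\eta_\beta^{(q)}.$$
   Context: $\mathbb{N}=\{0,1,2,\ldots\}$; for an integer $m$, $[m]=\{1,2,\ldots,m\}$ (empty if $m\le 0$). A composition is a finite tuple $\alpha=(\alpha_1,\ldots,\alpha_k)$ of positive integers; its length is $\ell(\alpha)=k$, its size is $|\alpha|=\alpha_1+\cdots+\alpha_k$. $\mathrm{Comp}$ is the set of all compositions (including the empty one), and $\mathrm{Comp}_n$ the set of compositions of size $n$. For $\alpha=(\alpha_1,\ldots,\alpha_k)\in\mathrm{Comp}_n$ set $D(\alpha)=\{\alpha_1+\cdots+\alpha_i \mid i\in[k-1]\}\subseteq[n-1]$. The reversal of $\alpha=(\alpha_1,\alpha_2,\ldots,\alpha_k)$ is $\mathrm{rev}\,\alpha=(\alpha_k,\alpha_{k-1},\ldots,\alpha_1)$. $\mathrm{QSym}$ is the Hopf algebra of quasisymmetric functions over $\mathbf{k}$ (a $\mathbf{k}$-subalgebra of $\mathbf{k}[[x_1,x_2,\ldots]]$). It has the $\mathbf{k}$-basis $(M_\alpha)_{\alpha\in\mathrm{Comp}}$ with $M_\alpha=\sum_{i_1<i_2<\cdots<i_\ell}x_{i_1}^{\alpha_1}\cdots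 x_{i_\ell}^{\alpha_\ell}$ for $\alpha=(\alpha_1,\ldots,\alpha_\ell)$. Its antipode is the $\mathbf{k}$-linear map $S:\mathrm{QSym}\to\mathrm{QSym}$ given by $S(M_\alpha)=(-1)^{\ell(\alpha)}\sum_{\gamma\in\mathrm{Comp}_n;\ D(\gamma)\subseteq D(\mathrm{rev}\,\alpha)}M_\gamma$ for all $n\in\mathbb{N}$ and $\alpha\in\mathrm{Comp}_n$. Set $r:=q+1$. For $\alpha\in\mathrm{Comp}_n$, $\eta_\alpha^{(q)}=\sum_{\beta\in\mathrm{Comp}_n;\ D(\beta)\subseteq D(\alpha)}r^{\ell(\beta)}M_\beta\in\mathrm{QSym}$. *)

theory Defs
  imports Complex_Main "HOL-Library.Poly_Mapping" "HOL-Library.Function_Algebras" "HOL-Library.FuncSet"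
begin

definition compositions :: "nat list set" where
  "compositions = {\<alpha>. \<forall>a\<in>set \<alpha>. 0 < a}"

definition Comp :: "nat \<Rightarrow> nat list set" where
  "Comp n = {\<alpha>\<in>compositions. sum_list \<alpha> = n}"

definition D :: "nat list \<Rightarrow> nat set" where
  "D \<alpha> = {sum_list (take i \<alpha>) | i. i \<in> {1..<length \<alpha>}}"

text \<open>
  A formal power series in countably many variables is its coefficient function on monomials,
  and a monomial is its finitely supported exponent vector. The index \<open>i :: nat\<close> stands for the
  variable usually written \<open>x\<^sub>i\<^sub>+\<^sub>1\<close>. Addition and finite sums of power series are the pointwise ones
  from \<^theory>\<open>HOL-Library.Function_Algebras\<close>; the pointwise product defined there is not the
  product of power series and is not used.

  The coefficients have sort \<open>{comm_ring, comm_monoid_mult}\<close>: commutative rings with one, where,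
  in contrast to \<^class>\<open>comm_ring_1\<close>, the zero ring is allowed.
\<close>

type_synonym 'k powser = "(nat \<Rightarrow>\<^sub>0 nat) \<Rightarrow> 'k"

definition scale :: "'k::times \<Rightarrow> 'k powser \<Rightarrow> 'k powser" where
  "scale c f = (\<lambda>m. c * f m)"

text \<open>The monomial with exponent \<open>\<alpha> ! j\<close> at the variable \<open>is ! j\<close>.\<close>

definition monom :: "nat list \<Rightarrow> nat list \<Rightarrow> (nat \<Rightarrow>\<^sub>0 nat)" where
  "monom is \<alpha> = (\<Sum>j<length \<alpha>. Poly_Mapping.single (is ! j) (\<alpha> ! j))"

definition mdeg :: "(nat \<Rightarrow>\<^sub>0 nat) \<Rightarrow> nat" where
  "mdeg m = (\<Sum>i\<in>Poly_Mapping.keys m. Poly_Mapping.lookup m i)"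

definition incr :: "nat \<Rightarrow> nat list set" where
  "incr l = {is. length is = l \<and> sorted_wrt (<) is}"

text \<open>Quasisymmetric functions: the quasisymmetric power series of bounded degree.\<close>

definition QSym :: "'k::zero powser set" where
  "QSym = {f. (\<exists>d. \<forall>m. f m \<noteq> 0 \<longrightarrow> mdeg m \<le> d) \<and>
              (\<forall>\<alpha>\<in>compositions. \<forall>is\<in>incr (length \<alpha>). \<forall>js\<in>incr (length \<alpha>).
                 f (monom is \<alpha>) = f (monom js \<alpha>))}"

text \<open>
  The coefficient of \<open>m\<close> in the infinite formal sum of all \<open>monom is \<alpha>\<close>. For a composition \<open>\<alpha>\<close> the
  index set below is finite, see \<open>monom_eq_iff\<close>.
\<close>

definition M :: "nat list \<Rightarrow> 'k::{comm_ring, comm_monoid_mult} powser" where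
  "M \<alpha> = (\<lambda>m. \<Sum>is | is \<in> incr (length \<alpha>) \<and> monom is \<alpha> = m. 1)"

definition is_antipode :: "('k::{comm_ring, comm_monoid_mult} powser \<Rightarrow> 'k powser) \<Rightarrow> bool" where
  "is_antipode S \<longleftrightarrow>
     S \<in> QSym \<rightarrow>\<^sub>E QSym \<and>
     (\<forall>f\<in>QSym. \<forall>g\<in>QSym. S (f + g) = S f + S g) \<and>
     (\<forall>c. \<forall>f\<in>QSym. S (scale c f) = scale c (S f)) \<and>
     (\<forall>n. \<forall>\<alpha>\<in>Comp n.
        S (M \<alpha>) = scale ((- 1) ^ length \<alpha>) (\<Sum>\<gamma> | \<gamma> \<in> Comp n \<and> D \<gamma> \<subseteq> D (rev \<alpha>). M \<gamma>))"

text \<open>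
  The antipode is taken to be undefined outside \<^const>\<open>QSym\<close>, which makes it unique. That it exists
  is \<open>antipode_spec\<close>.
\<close>

definition antipode :: "'k::{comm_ring, comm_monoid_mult} powser \<Rightarrow> 'k powser" where
  "antipode = (THE S. is_antipode S)"

text \<open>For \<open>\<alpha> \<in> Comp n\<close> the index set below is \<open>{\<beta>\<in>Comp n. D \<beta> \<subseteq> D \<alpha>}\<close>.\<close>

definition eta :: "'k::{comm_ring, comm_monoid_mult} \<Rightarrow> nat list \<Rightarrow> 'k powser" where
  "eta q \<alpha> = (\<Sum>\<beta> | \<beta> \<in> Comp (sum_list \<alpha>) \<and> D \<beta> \<subseteq> D \<alpha>. scale ((q + 1) ^ length \<beta>) (M \<beta>))"


subsection \<open>Existence and uniqueness of the antipode\<close>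

definition idx :: "(nat \<Rightarrow>\<^sub>0 nat) \<Rightarrow> nat list" where
  "idx m = sorted_list_of_set (Poly_Mapping.keys m)"

definition expo :: "(nat \<Rightarrow>\<^sub>0 nat) \<Rightarrow> nat list" where
  "expo m = map (Poly_Mapping.lookup m) (idx m)"

lemma lookup_monom:
  "Poly_Mapping.lookup (monom is \<alpha>) k = (\<Sum>j<length \<alpha>. if is ! j = k then \<alpha> ! j else 0)"
  by (simp add: monom_def Poly_Mapping.lookup_sum lookup_single when_def)

lemma lookup_monom_nth:
  assumes "is \<in> incr (length \<alpha>)" "j < length \<alpha>"
  shows "Poly_Mapping.lookup (monom is \<alpha>) (is ! j) = \<alpha> ! j"
proof -
  have d: "distinct is" "length is = length \<alpha>"
    using assms by (auto simp: incr_def strict_sorted_iff)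
  have "(\<Sum>i<length \<alpha>. if is ! i = is ! j then \<alpha> ! i else 0) = (\<Sum>i<length \<alpha>. if i = j then \<alpha> ! i else 0)"
    by (rule sum.cong) (use d assms in \<open>auto simp: nth_eq_iff_index_eq\<close>)
  with assms show ?thesis by (simp add: lookup_monom)
qed

lemma keys_monom:
  assumes "\<alpha> \<in> compositions" "is \<in> incr (length \<alpha>)"
  shows "Poly_Mapping.keys (monom is \<alpha>) = set is"
proof (intro equalityI subsetI)
  fix k assume "k \<in> Poly_Mapping.keys (monom is \<alpha>)"
  then have "(\<Sum>j<length \<alpha>. if is ! j = k then \<alpha> ! j else 0) \<noteq> 0"
    by (simp add: in_keys_iff lookup_monom)
  then obtain j where "j \<in> {..<length \<alpha>}" "(if is ! j = k then \<alpha> ! j else 0) \<noteq> 0"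
    by (rule sum.not_neutral_contains_not_neutral)
  then have "j < length \<alpha>" "is ! j = k" by (auto split: if_splits)
  then show "k \<in> set is" using assms by (auto simp: incr_def)
next
  fix k assume "k \<in> set is"
  then obtain j where "j < length \<alpha>" "k = is ! j"
    using assms by (auto simp: in_set_conv_nth incr_def)
  then show "k \<in> Poly_Mapping.keys (monom is \<alpha>)"
    using assms lookup_monom_nth[OF assms(2)] by (simp add: in_keys_iff compositions_def)
qed

lemma idx_monom:
  assumes "\<alpha> \<in> compositions" "is \<in> incr (length \<alpha>)"
  shows "idx (monom is \<alpha>) = is"
  using assms by (auto simp: idx_def keys_monom incr_def intro: sorted_list_of_set.idem_if_sorted_distinct
      simp: strict_sorted_iff)

lemma expo_monom:
  assumes "\<alpha> \<in> compositions" "is \<in> incr (length \<alpha>)"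
  shows "expo (monom is \<alpha>) = \<alpha>"
  using assms lookup_monom_nth[OF assms(2)]
  by (intro nth_equalityI) (auto simp: expo_def idx_monom incr_def)

lemma expo_comp: "expo m \<in> compositions"
  by (auto simp: expo_def idx_def compositions_def in_keys_iff)

lemma idx_incr: "idx m \<in> incr (length (expo m))"
  by (simp add: idx_def incr_def expo_def)

lemma monom_idx_expo: "monom (idx m) (expo m) = m"
proof (rule poly_mapping_eqI)
  fix k
  show "Poly_Mapping.lookup (monom (idx m) (expo m)) k = Poly_Mapping.lookup m k"
  proof (cases "k \<in> Poly_Mapping.keys m")
    case True
    then have "k \<in> set (idx m)" by (simp add: idx_def)
    then obtain j where "j < length (expo m)" "k = idx m ! j"
      by (auto simp: in_set_conv_nth expo_def)
    then show ?thesis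
      using lookup_monom_nth[OF idx_incr, of j m] by (simp add: expo_def)
  next
    case False
    then have "k \<notin> Poly_Mapping.keys (monom (idx m) (expo m))"
      by (simp add: keys_monom[OF expo_comp idx_incr]) (simp add: idx_def)
    with False show ?thesis by (simp add: in_keys_iff)
  qed
qed

lemma monom_eq_iff:
  assumes "\<alpha> \<in> compositions"
  shows "is \<in> incr (length \<alpha>) \<and> monom is \<alpha> = m \<longleftrightarrow> is = idx m \<and> \<alpha> = expo m"
  using expo_monom[OF assms, of "is"] idx_monom[OF assms, of "is"] monom_idx_expo[of m] idx_incr[of m]
  by auto

lemma M_eq:
  assumes "\<alpha> \<in> compositions"
  shows "M \<alpha> m = (if expo m = \<alpha> then 1 else 0)"
proof -
  have "{is. is \<in> incr (length \<alpha>) \<and> monom is \<alpha> = m} = (if expo m = \<alpha> then {idx m} else {})"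
    using monom_eq_iff[OF assms] by auto
  then show ?thesis by (simp add: M_def)
qed

lemma mdeg_expo: "mdeg m = sum_list (expo m)"
  unfolding mdeg_def expo_def idx_def
  by (subst sum_list_distinct_conv_sum_set) auto

lemma finite_Comp: "finite (Comp n)"
proof (rule finite_subset)
  have "length \<alpha> \<le> sum_list \<alpha>" if "\<forall>a\<in>set \<alpha>. 0 < a" for \<alpha> :: "nat list"
    using that by (induction \<alpha>) auto
  moreover have "set \<alpha> \<subseteq> {..sum_list \<alpha>}" for \<alpha> :: "nat list"
    by (auto simp: member_le_sum_list)
  ultimately show "Comp n \<subseteq> {\<alpha>. set \<alpha> \<subseteq> {..n} \<and> length \<alpha> \<le> n}"
    by (fastforce simp: Comp_def compositions_def)
qed (rule finite_lists_length_le, simp)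

text \<open>\<open>coord \<alpha> f\<close> is the coefficient of \<open>M \<alpha>\<close> in \<open>f \<in> QSym\<close>.\<close>

definition coord :: "nat list \<Rightarrow> 'k powser \<Rightarrow> 'k" where
  "coord \<alpha> f = f (monom [0..<length \<alpha>] \<alpha>)"

definition upto_deg :: "nat \<Rightarrow> nat list set" where
  "upto_deg d = (\<Union>n\<le>d. Comp n)"

lemma finite_upto_deg [simp]: "finite (upto_deg d)"
  by (simp add: upto_deg_def finite_Comp)

lemma upto_deg_iff: "\<alpha> \<in> upto_deg d \<longleftrightarrow> \<alpha> \<in> compositions \<and> sum_list \<alpha> \<le> d"
  by (auto simp: upto_deg_def Comp_def)

lemma upt_incr: "[0..<l] \<in> incr l"
  by (simp add: incr_def)

lemma QSym_expo:
  assumes "f \<in> QSym" shows "f m = coord (expo m) f"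
proof -
  have "f (monom (idx m) (expo m)) = f (monom [0..<length (expo m)] (expo m))"
    using assms expo_comp idx_incr upt_incr by (auto simp: QSym_def)
  then show ?thesis by (simp add: monom_idx_expo coord_def)
qed

lemma sum_fun_apply: "(\<Sum>a\<in>A. F a) x = (\<Sum>a\<in>A. F a x)"
  for F :: "'i \<Rightarrow> 'b \<Rightarrow> 'c::comm_monoid_add"
  by (induction A rule: infinite_finite_induct) auto

lemma QSym_intro:
  assumes "\<And>m. f m \<noteq> 0 \<Longrightarrow> mdeg m \<le> d" "\<And>m. f m = F (expo m)"
  shows "f \<in> QSym"
  using assms by (auto simp: QSym_def expo_monom)

lemma M_QSym: "\<alpha> \<in> compositions \<Longrightarrow> M \<alpha> \<in> QSym"
  by (rule QSym_intro[where d = "sum_list \<alpha>" and F = "\<lambda>\<beta>. if \<beta> = \<alpha> then 1 else 0"])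
     (auto simp: M_eq mdeg_expo split: if_splits)

lemma QSym_0: "0 \<in> QSym"
  by (simp add: QSym_def)

lemma QSym_add:
  fixes f g :: "'k::comm_monoid_add powser"
  assumes "f \<in> QSym" "g \<in> QSym" shows "f + g \<in> QSym"
proof -
  obtain d e where "\<And>m. f m \<noteq> 0 \<Longrightarrow> mdeg m \<le> d" "\<And>m. g m \<noteq> 0 \<Longrightarrow> mdeg m \<le> e"
    using assms unfolding QSym_def by blast
  then have "mdeg m \<le> max d e" if "(f + g) m \<noteq> 0" for m
    using that by (cases "f m = 0") (auto simp: le_max_iff_disj)
  moreover have "(f + g) m = coord (expo m) f + coord (expo m) g" for m
    by (simp add: QSym_expo[OF assms(1)] QSym_expo[OF assms(2)])
  ultimately show ?thesis by (rule QSym_intro)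
qed

lemma QSym_scale:
  fixes f :: "'k::mult_zero powser"
  assumes "f \<in> QSym" shows "scale c f \<in> QSym"
proof -
  obtain d where d: "\<And>m. f m \<noteq> 0 \<Longrightarrow> mdeg m \<le> d"
    using assms unfolding QSym_def by blast
  have "mdeg m \<le> d" if "scale c f m \<noteq> 0" for m
    using that by (intro d) (auto simp: scale_def)
  moreover have "scale c f m = c * coord (expo m) f" for m
    unfolding scale_def by (subst QSym_expo[OF assms]) (rule refl)
  ultimately show ?thesis by (rule QSym_intro)
qed

lemma QSym_sum:
  fixes F :: "'i \<Rightarrow> 'k::comm_monoid_add powser"
  shows "(\<And>a. a \<in> A \<Longrightarrow> F a \<in> QSym) \<Longrightarrow> (\<Sum>a\<in>A. F a) \<in> QSym"
  by (induction A rule: infinite_finite_induct) (auto simp: QSym_0 QSym_add)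

lemma QSym_expand:
  fixes f :: "'k::{comm_ring, comm_monoid_mult} powser"
  assumes "f \<in> QSym"
  shows "\<exists>d. f = (\<Sum>\<alpha>\<in>upto_deg d. scale (coord \<alpha> f) (M \<alpha>)) \<and>
             {\<alpha>\<in>compositions. coord \<alpha> f \<noteq> 0} \<subseteq> upto_deg d"
proof -
  obtain d where d: "\<And>m. f m \<noteq> 0 \<Longrightarrow> mdeg m \<le> d"
    using assms unfolding QSym_def by blast
  have c: "\<alpha> \<in> upto_deg d" if "\<alpha> \<in> compositions" "coord \<alpha> f \<noteq> 0" for \<alpha>
    using d[of "monom [0..<length \<alpha>] \<alpha>"] that
    by (simp add: upto_deg_iff coord_def mdeg_expo expo_monom upt_incr)
  have "f m = (\<Sum>\<alpha>\<in>upto_deg d. coord \<alpha> f * M \<alpha> m)" for m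
  proof -
    have "(\<Sum>\<alpha>\<in>upto_deg d. coord \<alpha> f * M \<alpha> m) =
          (\<Sum>\<alpha>\<in>upto_deg d. if \<alpha> = expo m then coord \<alpha> f else 0)"
      by (rule sum.cong) (auto simp: M_eq upto_deg_iff)
    also have "\<dots> = f m"
      using c[of "expo m"] expo_comp[of m] QSym_expo[OF assms, of m] by auto
    finally show ?thesis by simp
  qed
  then have "f = (\<Sum>\<alpha>\<in>upto_deg d. scale (coord \<alpha> f) (M \<alpha>))"
    by (intro ext) (simp add: sum_fun_apply scale_def)
  moreover have "{\<alpha>\<in>compositions. coord \<alpha> f \<noteq> 0} \<subseteq> upto_deg d" using c by blast
  ultimately show ?thesis by (intro exI conjI)
qed

lemma linear_sum:
  fixes S :: "'k::{comm_ring, comm_monoid_mult} powser \<Rightarrow> 'k powser"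
  assumes "is_antipode S" "\<And>a. a \<in> A \<Longrightarrow> F a \<in> QSym"
  shows "S (\<Sum>a\<in>A. scale (c a) (F a)) = (\<Sum>a\<in>A. scale (c a) (S (F a)))"
proof -
  have "S (scale 0 0) = scale 0 (S 0)"
    using assms(1) QSym_0 unfolding is_antipode_def by blast
  then have S0: "S 0 = 0" by (simp add: scale_def zero_fun_def)
  have "S (f + g) = S f + S g" if "f \<in> QSym" "g \<in> QSym" for f g
    using assms(1) that unfolding is_antipode_def by blast
  moreover have "S (scale e f) = scale e (S f)" if "f \<in> QSym" for e f
    using assms(1) that unfolding is_antipode_def by blast
  ultimately show ?thesis
    using assms(2)
    by (induction A rule: infinite_finite_induct) (simp_all add: S0 QSym_sum QSym_scale)
qed

lemma is_antipode_unique: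
  fixes S T :: "'k::{comm_ring, comm_monoid_mult} powser \<Rightarrow> 'k powser"
  assumes "is_antipode S" "is_antipode T"
  shows "S = T"
proof (rule extensionalityI)
  show "S \<in> extensional QSym" "T \<in> extensional QSym"
    using assms unfolding is_antipode_def PiE_def by blast+
next
  fix f :: "'k powser" assume "f \<in> QSym"
  from QSym_expand[OF this] obtain d where d: "f = (\<Sum>\<alpha>\<in>upto_deg d. scale (coord \<alpha> f) (M \<alpha>))"
    by (elim exE conjE)
  have ST: "S (M \<alpha>) = T (M \<alpha>)" if "\<alpha> \<in> upto_deg d" for \<alpha>
  proof -
    have a: "\<alpha> \<in> Comp (sum_list \<alpha>)" using that by (simp add: upto_deg_iff Comp_def)
    have "R (M \<alpha>) = scale ((- 1) ^ length \<alpha>)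
        (\<Sum>\<gamma> | \<gamma> \<in> Comp (sum_list \<alpha>) \<and> D \<gamma> \<subseteq> D (rev \<alpha>). M \<gamma>)"
      if "is_antipode R" for R :: "'k powser \<Rightarrow> 'k powser"
      using that[unfolded is_antipode_def, THEN conjunct2, THEN conjunct2, THEN conjunct2, rule_format, OF a] .
    from this[OF assms(1)] this[OF assms(2)] show ?thesis by (simp only:)
  qed
  have MQ: "M \<alpha> \<in> QSym" if "\<alpha> \<in> upto_deg d" for \<alpha>
    using that by (simp add: M_QSym upto_deg_iff)
  have expand: "R f = (\<Sum>\<alpha>\<in>upto_deg d. scale (coord \<alpha> f) (R (M \<alpha>)))"
    if "is_antipode R" for R
  proof -
    have "R f = R (\<Sum>\<alpha>\<in>upto_deg d. scale (coord \<alpha> f) (M \<alpha>))"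
      by (rule arg_cong[OF d])
    also have "\<dots> = (\<Sum>\<alpha>\<in>upto_deg d. scale (coord \<alpha> f) (R (M \<alpha>)))"
      by (rule linear_sum[OF that]) (rule MQ)
    finally show ?thesis .
  qed
  have "(\<Sum>\<alpha>\<in>upto_deg d. scale (coord \<alpha> f) (S (M \<alpha>))) =
        (\<Sum>\<alpha>\<in>upto_deg d. scale (coord \<alpha> f) (T (M \<alpha>)))"
    by (rule sum.cong[OF refl], rule arg_cong[of _ _ "scale _"], rule ST)
  then have "S f = (\<Sum>\<alpha>\<in>upto_deg d. scale (coord \<alpha> f) (T (M \<alpha>)))"
    by (rule trans[OF expand[OF assms(1)]])
  then show "S f = T f" by (rule trans[OF _ expand[OF assms(2), symmetric]])
qed

lemma is_antipode_ex: "\<exists>S :: 'k::{comm_ring, comm_monoid_mult} powser \<Rightarrow> 'k powser. is_antipode S"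
proof -
  define T :: "nat list \<Rightarrow> 'k powser" where
    "T \<alpha> = scale ((- 1) ^ length \<alpha>) (\<Sum>\<gamma> | \<gamma> \<in> Comp (sum_list \<alpha>) \<and> D \<gamma> \<subseteq> D (rev \<alpha>). M \<gamma>)" for \<alpha>
  define supp where "supp f = {\<alpha>\<in>compositions. coord \<alpha> f \<noteq> 0}" for f :: "'k powser"
  define S where "S = restrict (\<lambda>f. \<Sum>\<alpha>\<in>supp f. scale (coord \<alpha> f) (T \<alpha>)) QSym"
  have TQ: "T \<alpha> \<in> QSym" for \<alpha>
    unfolding T_def by (intro QSym_scale QSym_sum M_QSym) (auto simp: Comp_def)
  have fin: "finite (supp f)" if f: "f \<in> QSym" for f
  proof -
    from QSym_expand[OF f] obtain d where "supp f \<subseteq> upto_deg d"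
      unfolding supp_def by (elim exE conjE)
    then show ?thesis by (rule finite_subset) simp
  qed
  have S: "S f = (\<Sum>\<alpha>\<in>A. scale (coord \<alpha> f) (T \<alpha>))"
    if "f \<in> QSym" "finite A" "supp f \<subseteq> A" "A \<subseteq> compositions" for f A
  proof -
    have "(\<Sum>\<alpha>\<in>supp f. scale (coord \<alpha> f) (T \<alpha>)) = (\<Sum>\<alpha>\<in>A. scale (coord \<alpha> f) (T \<alpha>))"
      using that by (intro sum.mono_neutral_left) (auto simp: supp_def scale_def zero_fun_def)
    with that show ?thesis by (simp add: S_def)
  qed
  have "S (f + g) = S f + S g" if fg: "f \<in> QSym" "g \<in> QSym" for f g
  proof -
    let ?A = "supp f \<union> supp g"
    have A: "finite ?A" "?A \<subseteq> compositions" using fg fin by (auto simp: supp_def)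
    have "supp (f + g) \<subseteq> ?A" by (auto simp: supp_def coord_def)
    with A have "S (f + g) = (\<Sum>\<alpha>\<in>?A. scale (coord \<alpha> (f + g)) (T \<alpha>))"
      by (intro S QSym_add fg)
    also have "\<dots> = (\<Sum>\<alpha>\<in>?A. scale (coord \<alpha> f) (T \<alpha>) + scale (coord \<alpha> g) (T \<alpha>))"
      by (intro sum.cong refl ext) (simp add: scale_def coord_def distrib_right)
    also have "\<dots> = S f + S g"
      using A by (simp add: S[of _ ?A] fg sum.distrib)
    finally show ?thesis .
  qed
  moreover have "S (scale c f) = scale c (S f)" if f: "f \<in> QSym" for c f
  proof -
    have A: "finite (supp f)" "supp f \<subseteq> compositions" using f fin by (auto simp: supp_def)
    have "supp (scale c f) \<subseteq> supp f" by (auto simp: supp_def coord_def scale_def)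
    with A have "S (scale c f) = (\<Sum>\<alpha>\<in>supp f. scale (coord \<alpha> (scale c f)) (T \<alpha>))"
      by (intro S QSym_scale f)
    also have "\<dots> = scale c (\<Sum>\<alpha>\<in>supp f. scale (coord \<alpha> f) (T \<alpha>))"
      by (intro ext) (simp add: sum_fun_apply scale_def coord_def sum_distrib_left mult.assoc)
    also have "(\<Sum>\<alpha>\<in>supp f. scale (coord \<alpha> f) (T \<alpha>)) = S f"
      using S[OF f A(1) order_refl A(2)] by simp
    finally show ?thesis .
  qed
  moreover have "S (M \<alpha>) = T \<alpha>" if a: "\<alpha> \<in> compositions" for \<alpha>
  proof -
    have c: "coord \<beta> (M \<alpha>) = (if \<beta> = \<alpha> then 1 else 0 :: 'k)" if "\<beta> \<in> compositions" for \<beta>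
      using a that by (simp add: coord_def M_eq expo_monom upt_incr)
    then have "supp (M \<alpha>) \<subseteq> {\<alpha>}" by (auto simp: supp_def split: if_splits)
    then have "S (M \<alpha>) = (\<Sum>\<beta>\<in>{\<alpha>}. scale (coord \<beta> (M \<alpha>)) (T \<beta>))"
      using a by (intro S M_QSym) auto
    with a show ?thesis by (simp add: c scale_def)
  qed
  moreover have "S \<in> QSym \<rightarrow>\<^sub>E QSym"
    unfolding S_def by (simp add: QSym_sum QSym_scale TQ)
  ultimately show ?thesis
    unfolding is_antipode_def
    by (intro exI[of _ S]) (simp add: T_def Comp_def)
qed

lemma antipode_spec: "is_antipode (antipode :: 'a::{comm_ring, comm_monoid_mult} powser \<Rightarrow> 'a powser)"
proof -
  have "\<exists>!S :: 'a powser \<Rightarrow> 'a powser. is_antipode S"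
    using is_antipode_ex is_antipode_unique by blast
  then show ?thesis unfolding antipode_def by (rule theI')
qed

lemma eta_QSym: "eta q \<alpha> \<in> QSym"
  unfolding eta_def by (intro QSym_sum QSym_scale M_QSym) (auto simp: Comp_def)

end

theory Submission
  imports Defs
begin

text \<open>
  Both sides are compared coefficientwise in the monomial basis. Fix a composition \<open>\<gamma>\<close> of \<open>n\<close>, and
  write \<open>a\<close>, \<open>b\<close>, \<open>c\<close> for the lengths of \<open>\<alpha>\<close>, \<open>\<beta>\<close>, \<open>\<gamma>\<close> and \<open>r = q + 1\<close>.
  Reversal reflects \<open>D\<close> by \<open>d \<mapsto> n - d\<close>, so \<open>D \<gamma> \<subseteq> D (rev \<beta>)\<close> says the same as
  \<open>D (rev \<gamma>) \<subseteq> D \<beta>\<close> (\<open>D_subset_D_rev_iff\<close>). Hence by linearity of the antipode the coefficient of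
  \<open>M \<gamma>\<close> on the left is the sum of \<open>(- r) ^ b\<close> over the interval \<open>D (rev \<gamma>) \<subseteq> D \<beta> \<subseteq> D \<alpha>\<close>, and on
  the right it is \<open>(- 1) ^ a * r ^ c\<close> times the sum of \<open>(q - 1) ^ (a - b)\<close> over the interval
  \<open>D \<gamma> \<subseteq> D \<beta> \<subseteq> D (rev \<alpha>)\<close>.

  Since \<open>D\<close> identifies the compositions of \<open>n > 0\<close> with the subsets of \<open>{1..<n}\<close>, each interval is
  a Boolean lattice of rank \<open>a - c\<close>, if it is not empty, and the sum over it is a binomial expansion
  (\<open>sum_composition_interval\<close>). The left sum is
  \<open>(- r) ^ c * (1 - r) ^ (a - c) = (- r) ^ c * (- q) ^ (a - c)\<close>, the right sum is
  \<open>((q - 1) + 1) ^ (a - c) = q ^ (a - c)\<close>, and the two coefficients agree.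
\<close>

section \<open>Compositions and subsets\<close>

lemma D_Nil [simp]: "D [] = {}"
  by (simp add: D_def)

lemma D_singleton [simp]: "D [a] = {}"
  by (simp add: D_def)

text \<open>
  Splitting off the last part leaves the other partial sums unshifted, which is why the inductions
  on compositions below run from the right end.
\<close>

lemma D_snoc:
  assumes "\<beta> \<noteq> []"
  shows "D (\<beta> @ [b]) = insert (sum_list \<beta>) (D \<beta>)"
proof -
  have "{1..<length (\<beta> @ [b])} = insert (length \<beta>) {1..<length \<beta>}"
    using assms by (auto simp: Suc_le_eq)
  then have "D (\<beta> @ [b]) = (\<lambda>i. sum_list (take i (\<beta> @ [b]))) ` insert (length \<beta>) {1..<length \<beta>}"
    unfolding D_def Setcompr_eq_image by (simp only:)
  also have "\<dots> = insert (sum_list \<beta>) ((\<lambda>i. sum_list (take i \<beta>)) ` {1..<length \<beta>})"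
    by auto
  also have "(\<lambda>i. sum_list (take i \<beta>)) ` {1..<length \<beta>} = D \<beta>"
    by (auto simp: D_def)
  finally show ?thesis .
qed

lemma compositions_snoc_iff:
  "\<beta> @ [b] \<in> compositions \<longleftrightarrow> \<beta> \<in> compositions \<and> 0 < b"
  by (auto simp: compositions_def)

lemma sum_list_composition_pos:
  "\<beta> \<in> compositions \<Longrightarrow> \<beta> \<noteq> [] \<Longrightarrow> 0 < sum_list \<beta>"
  by (cases \<beta>) (auto simp: compositions_def)

lemma Comp_eq_Nil_iff: "\<beta> \<in> Comp n \<Longrightarrow> \<beta> = [] \<longleftrightarrow> n = 0"
  using sum_list_composition_pos[of \<beta>] unfolding Comp_def by fastforce

lemma D_subset:
  "\<beta> \<in> compositions \<Longrightarrow> D \<beta> \<subseteq> {1..<sum_list \<beta>}"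
proof (induction \<beta> rule: rev_induct)
  case (snoc b \<beta>)
  then have "D \<beta> \<subseteq> {1..<sum_list \<beta>}" "\<beta> \<in> compositions" "0 < b"
    by (auto simp: compositions_snoc_iff)
  then show ?case
    by (cases "\<beta> = []") (auto simp: D_snoc Suc_le_eq sum_list_composition_pos)
qed simp

lemma finite_D: "\<beta> \<in> compositions \<Longrightarrow> finite (D \<beta>)"
  by (rule finite_subset[OF D_subset]) auto

lemma card_D:
  "\<beta> \<in> compositions \<Longrightarrow> card (D \<beta>) = length \<beta> - 1"
proof (induction \<beta> rule: rev_induct)
  case (snoc b \<beta>)
  then have \<beta>: "card (D \<beta>) = length \<beta> - 1" "\<beta> \<in> compositions"
    by (auto simp: compositions_snoc_iff)
  have "sum_list \<beta> \<notin> D \<beta>" using D_subset[OF \<beta>(2)] by auto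
  with \<beta> show ?case
    by (cases "\<beta> = []") (simp_all add: D_snoc finite_D)
qed simp

text \<open>
  A length exceeds the cardinality of \<open>D\<close> by one if \<open>n > 0\<close>, but equals it if \<open>n = 0\<close>. Passing to
  differences removes this case distinction from everything that follows.
\<close>

lemma length_diff_eq_card_D_diff:
  assumes "\<beta> \<in> Comp n" "\<gamma> \<in> Comp n"
  shows "length \<beta> - length \<gamma> = card (D \<beta>) - card (D \<gamma>)"
proof -
  have "\<beta> = [] \<longleftrightarrow> \<gamma> = []"
    using assms by (simp add: Comp_eq_Nil_iff)
  with assms show ?thesis
    by (cases \<beta>; cases \<gamma>) (auto simp: Comp_def card_D)
qed

lemma Max_D_snoc:
  assumes "\<beta> \<in> compositions" "\<beta> \<noteq> []"
  shows "Max (D (\<beta> @ [b])) = sum_list \<beta>"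
  using D_subset[OF assms(1)] finite_D[OF assms(1)] assms(2)
  by (intro Max_eqI) (auto simp: D_snoc)

text \<open>
  If there are at least two parts, the largest element of \<open>D \<beta>\<close> is the sum of all parts but the last. It determines the last part,
  and removing it leaves the set \<open>D\<close> of the remaining parts.
\<close>

lemma D_inject:
  assumes "\<beta> \<in> compositions" "\<gamma> \<in> compositions" "sum_list \<beta> = sum_list \<gamma>" "D \<beta> = D \<gamma>"
  shows "\<beta> = \<gamma>"
  using assms
proof (induction \<beta> arbitrary: \<gamma> rule: rev_induct)
  case Nil
  then have "sum_list \<gamma> = 0" by (metis sum_list.Nil)
  then show ?case using sum_list_composition_pos Nil.prems(2) by (metis less_irrefl)
next
  case (snoc b \<beta>)
  then have \<beta>: "\<beta> \<in> compositions" "0 < b" by (auto simp: compositions_snoc_iff)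
  have "\<gamma> \<noteq> []" using snoc.prems \<beta> by auto
  then obtain \<gamma>' c where \<gamma>: "\<gamma> = \<gamma>' @ [c]" by (cases \<gamma> rule: rev_cases) auto
  then have \<gamma>': "\<gamma>' \<in> compositions" using snoc.prems by (auto simp: compositions_snoc_iff)
  have empty: "\<beta> = [] \<longleftrightarrow> \<gamma>' = []"
    using snoc.prems(4) by (cases "\<beta> = []"; cases "\<gamma>' = []") (auto simp: \<gamma> D_snoc)
  show ?case
  proof (cases "\<beta> = []")
    case True
    with empty snoc.prems show ?thesis by (simp add: \<gamma>)
  next
    case False
    with empty have ne: "\<gamma>' \<noteq> []" by simp
    have s: "sum_list \<beta> = sum_list \<gamma>'"
      using Max_D_snoc[OF \<beta>(1) False, of b] Max_D_snoc[OF \<gamma>' ne, of c] snoc.prems(4)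
      by (simp add: \<gamma>)
    have "sum_list \<beta> \<notin> D \<beta>" "sum_list \<gamma>' \<notin> D \<gamma>'"
      using D_subset[OF \<beta>(1)] D_subset[OF \<gamma>'] by auto
    then have "D \<beta> = D \<gamma>'"
      using snoc.prems(4) False ne s by (simp add: \<gamma> D_snoc insert_ident)
    with snoc.IH[OF \<beta>(1) \<gamma>' s] snoc.prems(3) s show ?thesis by (simp add: \<gamma>)
  qed
qed

text \<open>
  By the same token, the smaller elements of \<open>X\<close> give a composition of \<open>Max X\<close>, to which the part
  \<open>n - Max X\<close> is appended.
\<close>

lemma ex_composition_D_eq:
  assumes "0 < n" "X \<subseteq> {1..<n}"
  shows "\<exists>\<beta>\<in>Comp n. D \<beta> = X"
  using assms
proof (induction n arbitrary: X rule: less_induct)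
  case (less n)
  have fin: "finite X" using less.prems(2) by (rule finite_subset) simp
  show ?case
  proof (cases "X = {}")
    case True
    with less.prems(1) show ?thesis
      by (intro bexI[of _ "[n]"]) (auto simp: Comp_def compositions_def)
  next
    case False
    define m where "m = Max X"
    have m: "m \<in> X" "\<And>x. x \<in> X \<Longrightarrow> x \<le> m" using fin False by (auto simp: m_def)
    then have mn: "0 < m" "m < n" using less.prems(2) by auto
    have "X - {m} \<subseteq> {1..<m}"
      using m(2) less.prems(2) by (auto simp: order.strict_iff_order)
    then obtain \<beta> where \<beta>: "\<beta> \<in> Comp m" "D \<beta> = X - {m}"
      using less.IH[OF mn(2,1)] by blast
    have "\<beta> \<noteq> []" using Comp_eq_Nil_iff[OF \<beta>(1)] mn(1) by simp
    moreover have "sum_list \<beta> = m" using \<beta>(1) by (simp add: Comp_def)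
    ultimately have "D (\<beta> @ [n - m]) = X"
      by (simp add: D_snoc \<beta>(2) insert_absorb[OF m(1)])
    moreover have "\<beta> @ [n - m] \<in> Comp n"
      using \<beta>(1) mn by (simp add: Comp_def compositions_snoc_iff)
    ultimately show ?thesis by blast
  qed
qed

lemma bij_betw_D_interval:
  assumes "\<alpha> \<in> Comp n"
  shows "bij_betw D {\<beta>. \<beta> \<in> Comp n \<and> D \<gamma> \<subseteq> D \<beta> \<and> D \<beta> \<subseteq> D \<alpha>} {X. D \<gamma> \<subseteq> X \<and> X \<subseteq> D \<alpha>}"
proof (rule bij_betw_imageI)
  show "inj_on D {\<beta>. \<beta> \<in> Comp n \<and> D \<gamma> \<subseteq> D \<beta> \<and> D \<beta> \<subseteq> D \<alpha>}"
    by (intro inj_onI D_inject) (auto simp: Comp_def)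
  have "\<exists>\<beta>\<in>Comp n. D \<beta> = X" if "X \<subseteq> D \<alpha>" for X
  proof (cases "n = 0")
    case True
    with assms have "\<alpha> = []" by (simp add: Comp_eq_Nil_iff)
    with that assms show ?thesis by (intro bexI[of _ "[]"]) auto
  next
    case False
    have "D \<alpha> \<subseteq> {1..<n}" using assms D_subset by (auto simp: Comp_def)
    with False that show ?thesis by (intro ex_composition_D_eq) auto
  qed
  then show "D ` {\<beta>. \<beta> \<in> Comp n \<and> D \<gamma> \<subseteq> D \<beta> \<and> D \<beta> \<subseteq> D \<alpha>} = {X. D \<gamma> \<subseteq> X \<and> X \<subseteq> D \<alpha>}"
    by blast
qed

section \<open>Reversal\<close>

lemma rev_Comp_iff [simp]: "rev \<alpha> \<in> Comp n \<longleftrightarrow> \<alpha> \<in> Comp n"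
  by (auto simp: Comp_def compositions_def)

lemma D_rev_subset: "(\<lambda>d. sum_list \<alpha> - d) ` D \<alpha> \<subseteq> D (rev \<alpha>)"
proof
  fix e assume "e \<in> (\<lambda>d. sum_list \<alpha> - d) ` D \<alpha>"
  then obtain i where i: "1 \<le> i" "i < length \<alpha>" "e = sum_list \<alpha> - sum_list (take i \<alpha>)"
    by (auto simp: D_def)
  have "sum_list \<alpha> = sum_list (take i \<alpha>) + sum_list (drop i \<alpha>)"
    by (metis append_take_drop_id sum_list_append)
  with i have "e = sum_list (take (length \<alpha> - i) (rev \<alpha>))"
    by (simp add: take_rev)
  then show "e \<in> D (rev \<alpha>)"
    unfolding D_def using i by (auto intro!: exI[of _ "length \<alpha> - i"])
qed

text \<open>
  The reflection \<open>d \<mapsto> sum_list \<alpha> - d\<close> is its own inverse on \<open>{..sum_list \<alpha>}\<close>, so the previous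
  inclusion applied to \<open>rev \<alpha>\<close> yields the converse one for \<open>\<alpha>\<close>.
\<close>

lemma D_rev:
  assumes "\<alpha> \<in> compositions"
  shows "D (rev \<alpha>) = (\<lambda>d. sum_list \<alpha> - d) ` D \<alpha>"
proof
  have c: "rev \<alpha> \<in> compositions" using assms by (simp add: compositions_def)
  show "D (rev \<alpha>) \<subseteq> (\<lambda>d. sum_list \<alpha> - d) ` D \<alpha>"
  proof
    fix d assume d: "d \<in> D (rev \<alpha>)"
    then have "sum_list \<alpha> - d \<in> D \<alpha>" using D_rev_subset[of "rev \<alpha>"] by auto
    moreover have "sum_list \<alpha> - (sum_list \<alpha> - d) = d" using D_subset[OF c] d by auto
    ultimately show "d \<in> (\<lambda>d. sum_list \<alpha> - d) ` D \<alpha>" by (metis imageI)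
  qed
qed (rule D_rev_subset)

lemma D_subset_D_rev_iff:
  assumes "\<beta> \<in> Comp n" "\<gamma> \<in> Comp n"
  shows "D \<gamma> \<subseteq> D (rev \<beta>) \<longleftrightarrow> D (rev \<gamma>) \<subseteq> D \<beta>"
proof -
  have "D (rev \<mu>) \<subseteq> D (rev \<nu>)" if "\<mu> \<in> Comp n" "\<nu> \<in> Comp n" "D \<mu> \<subseteq> D \<nu>" for \<mu> \<nu>
    using that by (auto simp: D_rev Comp_def)
  from this[of \<gamma> "rev \<beta>"] this[of "rev \<gamma>" \<beta>] assms show ?thesis by auto
qed

section \<open>Binomial sums over intervals\<close>

text \<open>
  This is the binomial theorem, indexed by subsets rather than by their cardinalities so that it can
  be carried over to intervals, and valid also in the zero ring. Among the subsets of
  \<open>insert a F\<close>, those without \<open>a\<close> contribute a factor \<open>y\<close> and those with \<open>a\<close> a factor \<open>x\<close>.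
\<close>

lemma sum_Pow_power:
  fixes x y :: "'k::{comm_ring, comm_monoid_mult}"
  assumes "finite F"
  shows "(\<Sum>Y\<in>Pow F. x ^ card Y * y ^ (card F - card Y)) = (x + y) ^ card F"
  using assms
proof (induction F rule: finite_induct)
  case empty
  show ?case by simp
next
  case (insert a F)
  let ?t = "\<lambda>G Y. x ^ card Y * y ^ (card G - card Y)"
  have inj: "inj_on (insert a) (Pow F)" using insert.hyps by (auto simp: inj_on_def)
  have card: "card Y \<le> card F" "finite Y" "a \<notin> Y" if "Y \<in> Pow F" for Y
    using that insert.hyps by (auto intro: card_mono finite_subset)
  have "(\<Sum>Y\<in>Pow (insert a F). ?t (insert a F) Y) =
      (\<Sum>Y\<in>Pow F. ?t (insert a F) Y) + (\<Sum>Y\<in>insert a ` Pow F. ?t (insert a F) Y)"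
    unfolding Pow_insert using insert.hyps by (intro sum.union_disjoint) auto
  also have "(\<Sum>Y\<in>insert a ` Pow F. ?t (insert a F) Y) = (\<Sum>Y\<in>Pow F. x * ?t F Y)"
    using insert.hyps card by (simp add: sum.reindex[OF inj] mult.assoc)
  also have "(\<Sum>Y\<in>Pow F. ?t (insert a F) Y) = (\<Sum>Y\<in>Pow F. y * ?t F Y)"
    using insert.hyps card by (intro sum.cong) (auto simp: Suc_diff_le mult_ac)
  also have "(\<Sum>Y\<in>Pow F. y * ?t F Y) + (\<Sum>Y\<in>Pow F. x * ?t F Y) = (x + y) * (x + y) ^ card F"
    by (simp add: insert.IH flip: sum_distrib_left distrib_right) (simp add: add.commute)
  finally show ?case using insert.hyps by simp
qed

lemma sum_set_interval_power:
  fixes x y :: "'k::{comm_ring, comm_monoid_mult}"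
  assumes "finite B" "A \<subseteq> B"
  shows "(\<Sum>X | A \<subseteq> X \<and> X \<subseteq> B. x ^ (card X - card A) * y ^ (card B - card X)) =
    (x + y) ^ (card B - card A)"
proof -
  have finA: "finite A" using assms by (rule finite_subset[rotated])
  have "bij_betw ((\<union>) A) (Pow (B - A)) {X. A \<subseteq> X \<and> X \<subseteq> B}"
    by (rule bij_betw_byWitness[where f' = "\<lambda>X. X - A"]) (use assms in auto)
  then have "(\<Sum>X | A \<subseteq> X \<and> X \<subseteq> B. x ^ (card X - card A) * y ^ (card B - card X)) =
      (\<Sum>Y\<in>Pow (B - A). x ^ (card (A \<union> Y) - card A) * y ^ (card B - card (A \<union> Y)))"
    by (rule sum.reindex_bij_betw[symmetric])
  also have "\<dots> = (\<Sum>Y\<in>Pow (B - A). x ^ card Y * y ^ (card (B - A) - card Y))"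
  proof (rule sum.cong)
    fix Y assume Y: "Y \<in> Pow (B - A)"
    then have "finite Y" using assms finite_subset by blast
    with Y finA have "card (A \<union> Y) = card A + card Y" by (intro card_Un_disjoint) auto
    then show "x ^ (card (A \<union> Y) - card A) * y ^ (card B - card (A \<union> Y)) =
        x ^ card Y * y ^ (card (B - A) - card Y)"
      using card_Diff_subset[OF finA assms(2)] by simp
  qed simp
  also have "\<dots> = (x + y) ^ (card B - card A)"
    using assms finA sum_Pow_power[of "B - A" x y] by (simp add: card_Diff_subset)
  finally show ?thesis .
qed

lemma sum_composition_interval:
  fixes x y :: "'k::{comm_ring, comm_monoid_mult}"
  assumes "\<alpha> \<in> Comp n" "\<gamma> \<in> Comp n" "D \<gamma> \<subseteq> D \<alpha>"
  shows "(\<Sum>\<beta> | \<beta> \<in> Comp n \<and> D \<gamma> \<subseteq> D \<beta> \<and> D \<beta> \<subseteq> D \<alpha>.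
      x ^ (length \<beta> - length \<gamma>) * y ^ (length \<alpha> - length \<beta>)) = (x + y) ^ (length \<alpha> - length \<gamma>)"
    (is "sum ?f ?I = _")
proof -
  have "sum ?f ?I =
      (\<Sum>\<beta>\<in>?I. x ^ (card (D \<beta>) - card (D \<gamma>)) * y ^ (card (D \<alpha>) - card (D \<beta>)))"
    using assms length_diff_eq_card_D_diff[where n = n] by (intro sum.cong refl) auto
  also have "\<dots> = (\<Sum>X | D \<gamma> \<subseteq> X \<and> X \<subseteq> D \<alpha>. x ^ (card X - card (D \<gamma>)) * y ^ (card (D \<alpha>) - card X))"
    by (rule sum.reindex_bij_betw[OF bij_betw_D_interval[OF assms(1)]])
  also have "\<dots> = (x + y) ^ (length \<alpha> - length \<gamma>)"
    using assms finite_D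
    by (simp add: sum_set_interval_power length_diff_eq_card_D_diff Comp_def)
  finally show ?thesis .
qed

lemma length_mono_D:
  assumes "\<beta> \<in> Comp n" "\<gamma> \<in> Comp n" "D \<gamma> \<subseteq> D \<beta>"
  shows "length \<gamma> \<le> length \<beta>"
  using assms card_mono[of "D \<beta>" "D \<gamma>"] length_diff_eq_card_D_diff[of \<gamma> n \<beta>]
  by (simp add: Comp_def finite_D)

section \<open>Coefficients of the antipode\<close>

lemma antipode_M:
  assumes "\<alpha> \<in> Comp n"
  shows "antipode (M \<alpha> :: 'k::{comm_ring, comm_monoid_mult} powser) =
    scale ((- 1) ^ length \<alpha>) (\<Sum>\<gamma> | \<gamma> \<in> Comp n \<and> D \<gamma> \<subseteq> D (rev \<alpha>). M \<gamma>)"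
  using antipode_spec[where 'a = 'k] assms unfolding is_antipode_def by blast

lemma minus_power_eq:
  fixes x :: "'k::{comm_ring, comm_monoid_mult}"
  shows "(- x) ^ k = (- 1) ^ k * x ^ k"
proof -
  have "- x = - 1 * x" by (simp flip: minus_mult_left)
  then show ?thesis by (metis power_mult_distrib)
qed

text \<open>
  Every term has the factor \<open>(- x) ^ length \<gamma>\<close>, and what remains sums to
  \<open>(1 - x) ^ (length \<alpha> - length \<gamma>)\<close>. The signs of \<open>- x\<close> and \<open>1 - x = - (x - 1)\<close> then combine to
  \<open>(- 1) ^ length \<alpha>\<close>, independently of \<open>\<gamma>\<close>; this is why \<open>(- 1) ^ length \<alpha>\<close> can stand in front of
  the whole sum in the theorem. The lemma is used for \<open>x = q + 1\<close>, with \<open>x - 1 = q\<close>.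
\<close>

lemma sum_minus_power_interval:
  fixes x :: "'k::{comm_ring, comm_monoid_mult}"
  assumes "\<alpha> \<in> Comp n" "\<gamma> \<in> Comp n" "D \<gamma> \<subseteq> D \<alpha>"
  shows "(\<Sum>\<beta> | \<beta> \<in> Comp n \<and> D \<gamma> \<subseteq> D \<beta> \<and> D \<beta> \<subseteq> D \<alpha>. (- x) ^ length \<beta>) =
    (- 1) ^ length \<alpha> * x ^ length \<gamma> * (x - 1) ^ (length \<alpha> - length \<gamma>)"
    (is "sum ?f ?I = _")
proof -
  have "sum ?f ?I = (\<Sum>\<beta>\<in>?I. (- x) ^ length \<gamma> *
      ((- x) ^ (length \<beta> - length \<gamma>) * 1 ^ (length \<alpha> - length \<beta>)))"
    using assms by (intro sum.cong) (auto dest: length_mono_D simp flip: power_add)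
  also have "\<dots> = (- x) ^ length \<gamma> * (- x + 1) ^ (length \<alpha> - length \<gamma>)"
    by (simp only: sum_composition_interval[OF assms] flip: sum_distrib_left)
  also have "- x + 1 = - (x - 1)" by simp
  also have "(- x) ^ length \<gamma> * (- (x - 1)) ^ (length \<alpha> - length \<gamma>) =
      ((- 1) ^ length \<gamma> * (- 1) ^ (length \<alpha> - length \<gamma>)) * x ^ length \<gamma> * (x - 1) ^ (length \<alpha> - length \<gamma>)"
    unfolding minus_power_eq[of x] minus_power_eq[of "x - 1"] by (simp only: mult_ac)
  also have "(- 1 :: 'k) ^ length \<gamma> * (- 1) ^ (length \<alpha> - length \<gamma>) = (- 1) ^ length \<alpha>"
    using length_mono_D[OF assms] by (simp flip: power_add)
  finally show ?thesis .
qed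

text \<open>
  The condition that \<open>M \<gamma>\<close> occurs in the antipode of \<open>M \<beta>\<close> is rewritten as a lower bound on
  \<open>D \<beta>\<close>, so that each coefficient becomes a sum over an interval.
\<close>

lemma antipode_eta_expand:
  fixes q :: "'k::{comm_ring, comm_monoid_mult}"
  assumes "\<alpha> \<in> Comp n"
  shows "antipode (eta q \<alpha>) m =
    (\<Sum>\<gamma>\<in>Comp n. (\<Sum>\<beta> | \<beta> \<in> Comp n \<and> D (rev \<gamma>) \<subseteq> D \<beta> \<and> D \<beta> \<subseteq> D \<alpha>. (- (q + 1)) ^ length \<beta>) * M \<gamma> m)"
proof -
  define A where "A = {\<beta>. \<beta> \<in> Comp n \<and> D \<beta> \<subseteq> D \<alpha>}"
  have A: "finite A" "\<And>\<beta>. \<beta> \<in> A \<Longrightarrow> \<beta> \<in> Comp n" by (auto simp: A_def finite_Comp)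
  have n: "sum_list \<alpha> = n" using assms by (simp add: Comp_def)
  have "antipode (eta q \<alpha>) = (\<Sum>\<beta>\<in>A. scale ((q + 1) ^ length \<beta>) (antipode (M \<beta>)))"
    unfolding eta_def n A_def
    by (rule linear_sum[OF antipode_spec]) (auto simp: Comp_def intro: M_QSym)
  then have "antipode (eta q \<alpha>) m = (\<Sum>\<beta>\<in>A. scale ((q + 1) ^ length \<beta>) (antipode (M \<beta>))) m"
    by (rule fun_cong)
  also have "\<dots> = (\<Sum>\<beta>\<in>A. \<Sum>\<gamma> | \<gamma> \<in> Comp n \<and> D (rev \<gamma>) \<subseteq> D \<beta>. (- (q + 1)) ^ length \<beta> * M \<gamma> m)"
    unfolding sum_fun_apply
  proof (rule sum.cong)
    fix \<beta> assume "\<beta> \<in> A"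
    then have \<beta>: "\<beta> \<in> Comp n" by (rule A)
    have "scale ((q + 1) ^ length \<beta>) (antipode (M \<beta>)) m =
        (- (q + 1)) ^ length \<beta> * (\<Sum>\<gamma> | \<gamma> \<in> Comp n \<and> D \<gamma> \<subseteq> D (rev \<beta>). M \<gamma> m)"
      unfolding antipode_M[OF \<beta>] minus_power_eq[of "q + 1"]
      by (simp only: scale_def sum_fun_apply mult_ac)
    also have "{\<gamma>. \<gamma> \<in> Comp n \<and> D \<gamma> \<subseteq> D (rev \<beta>)} = {\<gamma>. \<gamma> \<in> Comp n \<and> D (rev \<gamma>) \<subseteq> D \<beta>}"
      using D_subset_D_rev_iff[OF \<beta>] by blast
    finally show "scale ((q + 1) ^ length \<beta>) (antipode (M \<beta>)) m =
        (\<Sum>\<gamma> | \<gamma> \<in> Comp n \<and> D (rev \<gamma>) \<subseteq> D \<beta>. (- (q + 1)) ^ length \<beta> * M \<gamma> m)"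
      by (simp only: sum_distrib_left)
  qed simp
  also have "\<dots> = (\<Sum>\<gamma>\<in>Comp n. \<Sum>\<beta> | \<beta> \<in> A \<and> D (rev \<gamma>) \<subseteq> D \<beta>. (- (q + 1)) ^ length \<beta> * M \<gamma> m)"
    by (rule sum.swap_restrict[OF A(1) finite_Comp])
  also have "\<dots> = (\<Sum>\<gamma>\<in>Comp n.
      (\<Sum>\<beta> | \<beta> \<in> Comp n \<and> D (rev \<gamma>) \<subseteq> D \<beta> \<and> D \<beta> \<subseteq> D \<alpha>. (- (q + 1)) ^ length \<beta>) * M \<gamma> m)"
    unfolding sum_distrib_right A_def by (intro sum.cong refl) auto
  finally show ?thesis .
qed

lemma sum_eta_expand:
  fixes q :: "'k::{comm_ring, comm_monoid_mult}"
  shows "(\<Sum>\<beta> | \<beta> \<in> Comp n \<and> D \<beta> \<subseteq> D \<alpha>. scale (w \<beta>) (eta q \<beta>)) m =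
    (\<Sum>\<gamma>\<in>Comp n. (\<Sum>\<beta> | \<beta> \<in> Comp n \<and> D \<gamma> \<subseteq> D \<beta> \<and> D \<beta> \<subseteq> D \<alpha>. w \<beta>) * (q + 1) ^ length \<gamma> * M \<gamma> m)"
proof -
  define A where "A = {\<beta>. \<beta> \<in> Comp n \<and> D \<beta> \<subseteq> D \<alpha>}"
  have A: "finite A" "\<And>\<beta>. \<beta> \<in> A \<Longrightarrow> sum_list \<beta> = n"
    unfolding A_def using finite_Comp[of n] by (simp, simp add: Comp_def)
  have "(\<Sum>\<beta>\<in>A. scale (w \<beta>) (eta q \<beta>)) m =
      (\<Sum>\<beta>\<in>A. \<Sum>\<gamma> | \<gamma> \<in> Comp n \<and> D \<gamma> \<subseteq> D \<beta>. w \<beta> * (q + 1) ^ length \<gamma> * M \<gamma> m)"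
    by (auto simp: sum_fun_apply scale_def eta_def A sum_distrib_left mult.assoc intro!: sum.cong)
  also have "\<dots> = (\<Sum>\<gamma>\<in>Comp n. \<Sum>\<beta> | \<beta> \<in> A \<and> D \<gamma> \<subseteq> D \<beta>. w \<beta> * (q + 1) ^ length \<gamma> * M \<gamma> m)"
    by (rule sum.swap_restrict[OF A(1) finite_Comp])
  also have "\<dots> = (\<Sum>\<gamma>\<in>Comp n.
      (\<Sum>\<beta> | \<beta> \<in> Comp n \<and> D \<gamma> \<subseteq> D \<beta> \<and> D \<beta> \<subseteq> D \<alpha>. w \<beta>) * (q + 1) ^ length \<gamma> * M \<gamma> m)"
    unfolding sum_distrib_right A_def by (intro sum.cong refl) auto
  finally show ?thesis unfolding A_def .
qed

theorem theorem3p16: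
  fixes q :: "'k::{comm_ring, comm_monoid_mult}" and n :: nat and \<alpha> :: "nat list"
  assumes "\<alpha> \<in> Comp n"
  shows "antipode (eta q \<alpha>) =
    scale ((- 1) ^ length \<alpha>)
      (\<Sum>\<beta> | \<beta> \<in> Comp n \<and> D \<beta> \<subseteq> D (rev \<alpha>). scale ((q - 1) ^ (length \<alpha> - length \<beta>)) (eta q \<beta>))"
proof
  fix m
  let ?L = "\<lambda>\<gamma>. \<Sum>\<beta> | \<beta> \<in> Comp n \<and> D (rev \<gamma>) \<subseteq> D \<beta> \<and> D \<beta> \<subseteq> D \<alpha>. (- (q + 1)) ^ length \<beta>"
  let ?R = "\<lambda>\<gamma>. \<Sum>\<beta> | \<beta> \<in> Comp n \<and> D \<gamma> \<subseteq> D \<beta> \<and> D \<beta> \<subseteq> D (rev \<alpha>). (q - 1) ^ (length \<alpha> - length \<beta>)"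
  have coeff: "?L \<gamma> = (- 1) ^ length \<alpha> * (?R \<gamma> * (q + 1) ^ length \<gamma>)" if \<gamma>: "\<gamma> \<in> Comp n" for \<gamma>
  proof (cases "D (rev \<gamma>) \<subseteq> D \<alpha>")
    case True
    then have sub: "D \<gamma> \<subseteq> D (rev \<alpha>)" using D_subset_D_rev_iff assms \<gamma> by blast
    have "?R \<gamma> = (1 + (q - 1)) ^ (length \<alpha> - length \<gamma>)"
      using sum_composition_interval[of "rev \<alpha>" n \<gamma> 1 "q - 1"] assms \<gamma> sub by simp
    moreover have "?L \<gamma> = (- 1) ^ length \<alpha> * (q + 1) ^ length \<gamma> * q ^ (length \<alpha> - length \<gamma>)"
      using sum_minus_power_interval[of \<alpha> n "rev \<gamma>" "q + 1"] assms \<gamma> True by simp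
    ultimately show ?thesis by (simp add: mult_ac)
  next
    case False
    then have "\<not> D \<gamma> \<subseteq> D (rev \<alpha>)" using D_subset_D_rev_iff assms \<gamma> by blast
    with False have "{\<beta>. \<beta> \<in> Comp n \<and> D (rev \<gamma>) \<subseteq> D \<beta> \<and> D \<beta> \<subseteq> D \<alpha>} = {}"
        "{\<beta>. \<beta> \<in> Comp n \<and> D \<gamma> \<subseteq> D \<beta> \<and> D \<beta> \<subseteq> D (rev \<alpha>)} = {}" by blast+
    then show ?thesis by (simp only: sum.empty mult_zero_left mult_zero_right)
  qed
  have "antipode (eta q \<alpha>) m = (\<Sum>\<gamma>\<in>Comp n. ?L \<gamma> * M \<gamma> m)"
    by (rule antipode_eta_expand[OF assms])
  also have "\<dots> = (- 1) ^ length \<alpha> * (\<Sum>\<gamma>\<in>Comp n. ?R \<gamma> * (q + 1) ^ length \<gamma> * M \<gamma> m)"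
    unfolding sum_distrib_left by (intro sum.cong refl) (simp only: coeff mult.assoc)
  finally show "antipode (eta q \<alpha>) m = scale ((- 1) ^ length \<alpha>)
      (\<Sum>\<beta> | \<beta> \<in> Comp n \<and> D \<beta> \<subseteq> D (rev \<alpha>). scale ((q - 1) ^ (length \<alpha> - length \<beta>)) (eta q \<beta>)) m"
    by (simp only: scale_def[of "(- 1) ^ length \<alpha>"] sum_eta_expand)
qed

end
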